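(* Let $\mathcal{X},\mathcal{Z}$ be finite sets, let $P_{XZ}$ be a probability distribution on $\mathcal{X}\times\mathcal{Z}$, and for each $n\ge1$ let $(X^n,Z^n)=((X_1,Z_1),\dots,(X_n,Z_n))$ be i.i.d. with common distribution $P_{XZ}$. Assume that $\sigma^2=\mathrm{Var}\left[\log\frac{1}{P_{X|Z}(X|Z)}\right]$ is positive, and put $\sigma=\sqrt{\sigma^2}$. Let $b\in\mathbb{R}$ be arbitrary. For any sequence of Slepian–Wolf codes $\{\Phi_n=(\phi_n,\psi_n)\}_{n\ge1}$, where $\phi_n:\mathcal{X}^n\to\{1,\dots,M_n\}$ and $\psi_n:\{1,\dots,M_n\}\times\mathcal{Z}^n\to\mathcal{X}^n$, if $$\limsup_{n\to\infty}\varepsilon(\Phi_n)<1-G\left(\frac{b}{\sigma}\right),$$ then $$\liminf_{n\to\infty}\frac{1}{\sqrt{n}}\log\frac{M_n}{e^{nH(X|Z)}}\ge b,$$ where $G(t)=\int_{-\infty}^t\frac{1}{\sqrt{2\pi}}e^{-u^2/2}\,du$ is the standard Gaussian cumulative distribution function.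
   Context: Logarithms are natural (base $e$). $H(X|Z)$ is the conditional Shannon entropy for $P_{XZ}$. A Slepian–Wolf code (source coding of $X^n$ with full side-information $Z^n$ at the decoder) is a pair of an encoder $\phi_n:\mathcal{X}^n\to\mathcal{M}_n=\{1,\dots,M_n\}$ and a decoder $\psi_n:\mathcal{M}_n\times\mathcal{Z}^n\to\mathcal{X}^n$; its error probability is $\varepsilon(\Phi_n)=P_{X^nZ^n}(\{(x^n,z^n):\psi_n(\phi_n(x^n),z^n)\ne x^n\})$. *)

theory Defs
  imports "HOL-Probability.Probability"
begin

text \<open>
  The alphabets are finite types \<open>'x\<close> and \<open>'z\<close>, so \<open>P :: ('x \<times> 'z) pmf\<close> is the joint law, with
  \<open>X = fst\<close> and \<open>Z = snd\<close>.  Words of length \<open>n\<close> are lists of length \<open>n\<close>, and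
  \<open>replicate_pmf n P\<close> is the law of \<open>n\<close> i.i.d. copies of the pair, whose two coordinate words are
  obtained by \<open>map fst\<close> and \<open>map snd\<close>.
\<close>

text \<open>Division by zero makes this \<open>0\<close> when the marginal vanishes at \<open>z\<close>, which is a null event.\<close>

definition conditional_mass :: "('x \<times> 'z) pmf \<Rightarrow> 'x \<Rightarrow> 'z \<Rightarrow> real" where
  "conditional_mass P x z = pmf P (x, z) / pmf (map_pmf snd P) z"

definition conditional_shannon_entropy :: "('x::finite \<times> 'z::finite) pmf \<Rightarrow> real" where
  "conditional_shannon_entropy P =
     prob_space.conditional_entropy (measure_pmf P) (exp 1) (count_space UNIV) (count_space UNIV) fst snd"

definition conditional_information_variance :: "('x::finite \<times> 'z::finite) pmf \<Rightarrow> real" where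
  "conditional_information_variance P =
     measure_pmf.variance P (\<lambda>(x, z). ln (1 / conditional_mass P x z))"

definition slepian_wolf_code ::
  "nat \<Rightarrow> nat \<Rightarrow> ('x list \<Rightarrow> nat) \<Rightarrow> (nat \<Rightarrow> 'z list \<Rightarrow> 'x list) \<Rightarrow> bool" where
  "slepian_wolf_code n M \<phi> \<psi> \<longleftrightarrow>
     (\<forall>x. length x = n \<longrightarrow> \<phi> x \<in> {1..M}) \<and>
     (\<forall>m\<in>{1..M}. \<forall>z. length z = n \<longrightarrow> length (\<psi> m z) = n)"

definition error_probability ::
  "('x \<times> 'z) pmf \<Rightarrow> nat \<Rightarrow> ('x list \<Rightarrow> nat) \<Rightarrow> (nat \<Rightarrow> 'z list \<Rightarrow> 'x list) \<Rightarrow> real" where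
  "error_probability P n \<phi> \<psi> =
     measure_pmf.prob (replicate_pmf n P) {w. \<psi> (\<phi> (map fst w)) (map snd w) \<noteq> map fst w}"

definition gaussian_cdf :: "real \<Rightarrow> real" where
  "gaussian_cdf t = (LBINT u:{..t}. 1 / sqrt (2 * pi) * exp (- (u\<^sup>2) / 2))"

end

theory Submission
  imports Defs "HOL-Real_Asymp.Real_Asymp"
begin

text \<open>
  A decoder that is given \<open>z\<close> can recover at most \<open>M\<close> words.  If each of these words has conditional
  probability below \<open>exp (- \<gamma>)\<close>, they contribute at most \<open>M * exp (- \<gamma>)\<close> to the success probability.
  Hence \<open>1 - \<epsilon> \<le> \<P>(J \<le> \<gamma>) + M * exp (- \<gamma>)\<close> for every \<open>\<gamma>\<close>, where
  \<open>J = ln (1 / P(X\<^sup>n | Z\<^sup>n))\<close> is a sum of i.i.d. terms of mean \<open>H(X | Z)\<close>.  If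
  \<open>ln M < n H + c \<surd>n\<close> infinitely often with \<open>c < b\<close>, take \<open>\<gamma> = n H + d \<surd>n\<close> with \<open>c < d < b\<close>: the
  second term vanishes and, by the central limit theorem, the first tends to
  \<open>G(d / \<sigma>) \<le> G(b / \<sigma>)\<close>, contradicting the bound on the error probability.
\<close>


section \<open>The law of i.i.d. words\<close>

lemma pmf_replicate_pmf:
  "pmf (replicate_pmf n p) xs = (if length xs = n then prod_list (map (pmf p) xs) else 0)"
proof (induction n arbitrary: xs)
  case 0
  then show ?case by (cases xs) auto
next
  case (Suc n)
  \<comment> \<open>Consing is injective, so the mass at \<open>y # ys\<close> is the product mass
    at \<open>(y, ys)\<close>.\<close>
  have eq: "replicate_pmf (Suc n) p = map_pmf (\<lambda>(x, xs). x # xs) (pair_pmf p (replicate_pmf n p))"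
    by (simp add: map_pmf_def pair_pmf_def bind_assoc_pmf bind_return_pmf)
  show ?case
  proof (cases xs)
    case Nil
    then show ?thesis
      by (auto simp: pmf_eq_0_set_pmf set_replicate_pmf simp del: replicate_pmf.simps)
  next
    case (Cons y ys)
    have "pmf (replicate_pmf (Suc n) p) xs = pmf (pair_pmf p (replicate_pmf n p)) (y, ys)"
      unfolding eq Cons
      using pmf_map_inj'[of "\<lambda>(x, xs). x # xs" "pair_pmf p (replicate_pmf n p)" "(y, ys)"]
      by (auto simp: inj_on_def)
    then show ?thesis
      by (simp add: Cons pmf_pair Suc.IH)
  qed
qed

text \<open>Links laws of finite words to an infinite product space, on which the central limit
  theorem can be applied. Lists over a countable type are countable, so it suffices to compare
  singletons, whose preimages are cylinders.\<close>

lemma distr_PiM_map_eq_replicate_pmf: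
  fixes p :: "'a::countable pmf"
  shows "(\<lambda>\<omega>. map \<omega> [0..<n]) \<in> (\<Pi>\<^sub>M i\<in>(UNIV::nat set). measure_pmf p) \<rightarrow>\<^sub>M count_space UNIV"
    and "distr (\<Pi>\<^sub>M i\<in>(UNIV::nat set). measure_pmf p) (count_space UNIV) (\<lambda>\<omega>. map \<omega> [0..<n]) =
      measure_pmf (replicate_pmf n p)"
proof -
  let ?\<Pi> = "\<Pi>\<^sub>M i\<in>(UNIV::nat set). measure_pmf p"
  interpret product_prob_space "\<lambda>_. measure_pmf p" "UNIV :: nat set" by unfold_locales
  have [measurable]: "(\<lambda>\<omega>. \<omega> i) \<in> ?\<Pi> \<rightarrow>\<^sub>M count_space UNIV" for i :: nat
    using measurable_component_singleton[of i UNIV "\<lambda>_. measure_pmf p"]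
    by (simp cong: measurable_cong_sets)
  have space: "space ?\<Pi> = UNIV"
    by (simp add: space_PiM PiE_def)
  have map_eq: "map \<omega> [0..<n] = xs \<longleftrightarrow> length xs = n \<and> (\<forall>i\<in>{..<n}. \<omega> i = xs ! i)"
    for \<omega> and xs :: "'a list"
    unfolding list_eq_iff_nth_eq by simp blast
  have vimage: "(\<lambda>\<omega>. map \<omega> [0..<n]) -` {xs} \<inter> space ?\<Pi> =
      (if length xs = n then {\<omega> \<in> space ?\<Pi>. \<forall>i\<in>{..<n}. \<omega> i \<in> {xs ! i}} else {})" for xs
    by (simp add: space vimage_def map_eq)
  show meas: "(\<lambda>\<omega>. map \<omega> [0..<n]) \<in> ?\<Pi> \<rightarrow>\<^sub>M count_space UNIV"
    by (subst measurable_count_space_eq2_countable) (auto simp: vimage)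
  show "distr ?\<Pi> (count_space UNIV) (\<lambda>\<omega>. map \<omega> [0..<n]) = measure_pmf (replicate_pmf n p)"
  proof (rule measure_eqI_countable[where A = UNIV])
    fix xs
    have "emeasure ?\<Pi> {\<omega> \<in> space ?\<Pi>. \<forall>i\<in>{..<n}. \<omega> i \<in> {xs ! i}} =
        (\<Prod>i<n. emeasure (measure_pmf p) {xs ! i})"
      by (subst emeasure_PiM_Collect) (auto simp: prob_space_measure_pmf)
    then have "emeasure ?\<Pi> ((\<lambda>\<omega>. map \<omega> [0..<n]) -` {xs} \<inter> space ?\<Pi>) =
        ennreal (pmf (replicate_pmf n p) xs)"
      by (auto simp: vimage pmf_replicate_pmf emeasure_pmf_single prod_ennreal prod.list_conv_set_nth
          atLeast0LessThan)
    then show "emeasure (distr ?\<Pi> (count_space UNIV) (\<lambda>\<omega>. map \<omega> [0..<n])) {xs} =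
        emeasure (measure_pmf (replicate_pmf n p)) {xs}"
      by (simp add: emeasure_distr meas emeasure_pmf_single)
  qed auto
qed

section \<open>Conditional information and the one-shot converse\<close>

lemma conditional_shannon_entropy_eq:
  "conditional_shannon_entropy P =
    measure_pmf.expectation P (\<lambda>(x, z). ln (1 / conditional_mass P x z))"
proof -
  \<comment> \<open>Since \<open>1 / 0 = 0\<close> and \<open>ln 0 = 0\<close>, letters of zero
    conditional mass obey the same identity.\<close>
  have ln_one_over: "ln (1 / x) = - ln x" if "x \<ge> 0" for x :: real
    using that by (cases "x = 0") (auto simp: ln_div)
  have nonneg: "conditional_mass P x z \<ge> 0" for x z
    by (simp add: conditional_mass_def)
  interpret information_space "measure_pmf P" "exp 1"
    by unfold_locales (simp add: one_less_exp_iff)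
  have pair: "count_space (UNIV :: 'a set) \<Otimes>\<^sub>M count_space (UNIV :: 'b set) = count_space UNIV"
    by (subst pair_measure_count_space) auto
  have Z: "distributed (measure_pmf P) (count_space UNIV) snd (\<lambda>z. pmf (map_pmf snd P) z)"
    unfolding distributed_def
    by (auto simp: map_pmf_rep_eq[symmetric] measure_pmf_eq_density[symmetric])
  have XZ: "distributed (measure_pmf P) (count_space UNIV \<Otimes>\<^sub>M count_space UNIV)
      (\<lambda>w. (fst w, snd w)) (\<lambda>w. pmf P w)"
    unfolding distributed_def pair
    by (auto simp: map_pmf_rep_eq[symmetric] measure_pmf_eq_density[symmetric])
  have "conditional_shannon_entropy P =
      - (\<integral>(x, z). pmf P (x, z) * log (exp 1) (pmf P (x, z) / pmf (map_pmf snd P) z)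
          \<partial>(count_space UNIV \<Otimes>\<^sub>M count_space UNIV))"
    unfolding conditional_shannon_entropy_def
    by (rule conditional_entropy_generic_eq[OF _ _ Z _ XZ])
       (auto simp: sigma_finite_measure_count_space_finite)
  also have "\<dots> = (\<Sum>(x, z)\<in>UNIV. pmf P (x, z) * ln (1 / conditional_mass P x z))"
    unfolding pair
    by (subst lebesgue_integral_count_space_finite)
       (auto simp: sum_negf[symmetric] log_def conditional_mass_def[symmetric]
         ln_one_over[OF nonneg]
         intro!: sum.cong)
  also have "\<dots> = measure_pmf.expectation P (\<lambda>(x, z). ln (1 / conditional_mass P x z))"
    by (subst integral_measure_pmf[of UNIV]) (auto simp: split_beta')
  finally show ?thesis .
qed

definition conditional_information :: "('x \<times> 'z) pmf \<Rightarrow> ('x \<times> 'z) list \<Rightarrow> real" where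
  "conditional_information P w = (\<Sum>(x, z)\<leftarrow>w. ln (1 / conditional_mass P x z))"

text \<open>Letter by letter, the joint mass is the conditional mass times the marginal mass. Off
  the support this can fail: a letter of zero conditional mass contributes information 0, hence a
  factor 1.\<close>

lemma pmf_replicate_pmf_conditional:
  assumes "w \<in> set_pmf (replicate_pmf n P)"
  shows "pmf (replicate_pmf n P) w =
    exp (- conditional_information P w) * pmf (replicate_pmf n (map_pmf snd P)) (map snd w)"
proof -
  have "prod_list (map (pmf P) w) =
      exp (- conditional_information P w) * prod_list (map (pmf (map_pmf snd P)) (map snd w))"
    if "set w \<subseteq> set_pmf P"
    using that
  proof (induction w)
    case Nil
    then show ?case by (simp add: conditional_information_def)
  next
    case (Cons a w)
    have z: "pmf (map_pmf snd P) (snd a) > 0"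
      using Cons.prems by (auto intro!: pmf_positive)
    have x: "pmf P a > 0"
      using Cons.prems by (auto intro!: pmf_positive)
    have "exp (ln (conditional_mass P (fst a) (snd a))) * pmf (map_pmf snd P) (snd a) = pmf P a"
      using x z by (simp add: conditional_mass_def)
    moreover have "ln (1 / conditional_mass P (fst a) (snd a)) = - ln (conditional_mass P (fst a) (snd a))"
      using x z by (simp add: conditional_mass_def ln_div)
    ultimately have step: "exp (- conditional_information P (a # w)) * pmf (map_pmf snd P) (snd a) =
        exp (- conditional_information P w) * pmf P a"
      by (simp add: conditional_information_def split_beta' exp_diff exp_minus field_simps)
    show ?case
      using Cons step by (simp add: mult_ac)
  qed
  with assms show ?thesis
    by (auto simp: pmf_replicate_pmf set_replicate_pmf lists_eq_set)
qed

text \<open>Correctly decoded words of information above \<gamma> inject into pairs of a message and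
  a side-information word \<open>z\<close>. Each has probability at most
  \<open>exp (- \<gamma>)\<close> times the marginal mass of \<open>z\<close>, and these masses sum
  to at most 1 for each message.\<close>

lemma success_probability_le:
  fixes P :: "('x::finite \<times> 'z::finite) pmf"
  assumes code: "slepian_wolf_code n M \<phi> \<psi>"
  shows "1 - error_probability P n \<phi> \<psi> \<le>
    measure_pmf.prob (replicate_pmf n P) {w. conditional_information P w \<le> \<gamma>} + real M * exp (- \<gamma>)"
proof -
  let ?R = "replicate_pmf n P"
  let ?Q = "replicate_pmf n (map_pmf snd P)"
  let ?C = "{w. \<psi> (\<phi> (map fst w)) (map snd w) = map fst w}"
  let ?T = "{w. conditional_information P w \<le> \<gamma>}"
  \<comment> \<open>Restricting to the support fixes the length of the words and makes the
    factorization of the mass available.\<close>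
  define D where "D = (?C - ?T) \<inter> set_pmf ?R"
  define L where "L = {z :: 'z list. length z = n}"
  define h where "h w = (\<phi> (map fst w), map snd w)" for w :: "('x \<times> 'z) list"
  have length: "length w = n" if "w \<in> D" for w
    using that by (auto simp: D_def set_replicate_pmf)
  have finL: "finite L"
    using finite_lists_length_eq[of "UNIV :: 'z set" n] by (simp add: L_def)
  have finD: "finite D"
    using finite_lists_length_eq[of "UNIV :: ('x \<times> 'z) set" n]
    by (rule finite_subset[rotated]) (auto simp: length)
  \<comment> \<open>a correctly decoded pair of words is determined by the message and the side information\<close>
  have inj: "inj_on h D"
  proof (rule inj_onI)
    fix v w assume v: "v \<in> D" and w: "w \<in> D" and eq: "h v = h w"
    have eqs: "\<phi> (map fst v) = \<phi> (map fst w)" "map snd v = map snd w"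
      using eq by (simp_all add: h_def)
    have "map fst v = \<psi> (\<phi> (map fst v)) (map snd v)"
      using v by (simp add: D_def)
    also have "\<dots> = map fst w"
      using w unfolding eqs by (simp add: D_def)
    finally show "v = w"
      using eqs(2) by (rule pair_list_eqI)
  qed
  have range: "h ` D \<subseteq> {1..M} \<times> L"
    using code by (auto simp: h_def L_def slepian_wolf_code_def length)
  have "measure_pmf.prob ?R (?C - ?T) = measure_pmf.prob ?R D"
    unfolding D_def by (rule measure_Int_set_pmf[symmetric])
  also have "\<dots> = (\<Sum>w\<in>D. pmf ?R w)"
    using finD by (rule measure_measure_pmf_finite)
  also have "\<dots> \<le> (\<Sum>w\<in>D. exp (- \<gamma>) * pmf ?Q (snd (h w)))"
  proof (rule sum_mono)
    fix w assume "w \<in> D"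
    then show "pmf ?R w \<le> exp (- \<gamma>) * pmf ?Q (snd (h w))"
      by (auto simp: D_def h_def pmf_replicate_pmf_conditional intro!: mult_right_mono)
  qed
  also have "\<dots> = (\<Sum>u\<in>h ` D. exp (- \<gamma>) * pmf ?Q (snd u))"
    by (simp add: sum.reindex[OF inj])
  \<comment> \<open>The summand ignores the message, so over the full rectangle each
    \<open>z\<close> is counted \<open>M\<close> times.\<close>
  also have "\<dots> \<le> (\<Sum>u\<in>{1..M} \<times> L. exp (- \<gamma>) * pmf ?Q (snd u))"
    using finL range by (intro sum_mono2) auto
  also have "\<dots> = real M * exp (- \<gamma>) * (\<Sum>z\<in>L. pmf ?Q z)"
    by (simp add: sum.cartesian_product' sum_distrib_left[symmetric])
  also have "(\<Sum>z\<in>L. pmf ?Q z) = measure_pmf.prob ?Q L"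
    using finL by (rule measure_measure_pmf_finite[symmetric])
  also have "real M * exp (- \<gamma>) * \<dots> \<le> real M * exp (- \<gamma>)"
    by (intro mult_right_le_one_le) auto
  finally have D: "measure_pmf.prob ?R (?C - ?T) \<le> real M * exp (- \<gamma>)" .
  have "1 - error_probability P n \<phi> \<psi> = measure_pmf.prob ?R ?C"
    unfolding error_probability_def
    by (subst measure_pmf.prob_compl[symmetric]) (auto intro!: arg_cong[where f = "measure_pmf.prob ?R"])
  also have "\<dots> \<le> measure_pmf.prob ?R (?T \<union> (?C - ?T))"
    by (rule measure_pmf.finite_measure_mono) auto
  also have "\<dots> \<le> measure_pmf.prob ?R ?T + measure_pmf.prob ?R (?C - ?T)"
    by (rule measure_subadditive) auto
  finally show ?thesis using D by linarith
qed

section \<open>The Gaussian distribution function and the central limit theorem\<close>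

lemma cdf_std_normal_distribution: "cdf std_normal_distribution = gaussian_cdf"
proof
  fix t :: real
  have "measure std_normal_distribution {..t} = (LINT u|std_normal_distribution. indicator {..t} u)"
    by simp
  also have "\<dots> = (LBINT u:{..t}. std_normal_density u)"
    by (subst integral_density) (auto simp: set_lebesgue_integral_def mult.commute)
  finally have "measure std_normal_distribution {..t} = (LBINT u:{..t}. std_normal_density u)" .
  then show "cdf std_normal_distribution t = gaussian_cdf t"
    by (simp add: cdf_def gaussian_cdf_def std_normal_density_def)
qed

text \<open>The normal law has no atoms. Continuity matters because weak convergence yields
  convergence of distribution functions only at continuity points.\<close>

lemma isCont_gaussian_cdf: "isCont gaussian_cdf t"
proof -
  interpret real_distribution std_normal_distribution by (rule real_dist_normal_dist)
  have "emeasure std_normal_distribution {t} = 0"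
    by (subst emeasure_density) (auto simp: nn_integral_null_set)
  then show ?thesis
    unfolding cdf_std_normal_distribution[symmetric] isCont_cdf by (simp add: measure_def)
qed

lemma gaussian_cdf_mono: "s \<le> t \<Longrightarrow> gaussian_cdf s \<le> gaussian_cdf t"
proof -
  interpret real_distribution std_normal_distribution by (rule real_dist_normal_dist)
  show "s \<le> t \<Longrightarrow> gaussian_cdf s \<le> gaussian_cdf t"
    unfolding cdf_std_normal_distribution[symmetric] by (rule cdf_nondecreasing)
qed

text \<open>The central limit theorem on the infinite product, carried over to words. The threshold
  is left unnormalized to match \<gamma>.\<close>

lemma replicate_pmf_central_limit:
  fixes p :: "'a::countable pmf" and f :: "'a \<Rightarrow> real"
  assumes int: "integrable p (\<lambda>x. (f x)\<^sup>2)"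
    and var: "measure_pmf.variance p f = \<sigma>\<^sup>2" and "\<sigma> > 0"
  shows "(\<lambda>n. measure_pmf.prob (replicate_pmf n p)
      {w. (\<Sum>x\<leftarrow>w. f x) \<le> real n * measure_pmf.expectation p f + \<sigma> * t * sqrt (real n)})
    \<longlonglongrightarrow> gaussian_cdf t"
proof -
  let ?\<Pi> = "\<Pi>\<^sub>M i\<in>(UNIV::nat set). measure_pmf p"
  define m where "m = measure_pmf.expectation p f"
  interpret product_prob_space "\<lambda>_. measure_pmf p" "UNIV :: nat set" by unfold_locales
  have comp [measurable]: "(\<lambda>\<omega>. \<omega> i) \<in> ?\<Pi> \<rightarrow>\<^sub>M measure_pmf p" for i :: nat
    by (rule measurable_component_singleton) simp
  have f [measurable]: "f \<in> borel_measurable (measure_pmf p)" by simp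
  have X: "(\<lambda>\<omega>. f (\<omega> i)) \<in> borel_measurable ?\<Pi>" for i by measurable
  have law: "distr ?\<Pi> (measure_pmf p) (\<lambda>\<omega>. \<omega> i) = measure_pmf p" for i
    by (rule PiM_component) simp
  have E: "P.expectation (\<lambda>\<omega>. g (\<omega> i)) = measure_pmf.expectation p g" for i and g :: "'a \<Rightarrow> real"
    using integral_distr[OF comp[of i], of g] unfolding law by simp
  have I: "integrable ?\<Pi> (\<lambda>\<omega>. g (\<omega> i)) \<longleftrightarrow> integrable p g" for i and g :: "'a \<Rightarrow> real"
    using integrable_distr_eq[OF comp[of i], of g] unfolding law by simp
  \<comment> \<open>The coordinates are independent because their joint law is the product measure
    itself.\<close>
  have indep: "P.indep_vars (\<lambda>_. borel) (\<lambda>i \<omega>. f (\<omega> i)) UNIV"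
  proof -
    have "P.indep_vars (\<lambda>_. measure_pmf p) (\<lambda>i \<omega>. \<omega> i) UNIV"
      by (subst P.indep_vars_iff_distr_eq_PiM') (auto simp: law restrict_UNIV distr_id2)
    from P.indep_vars_compose2[OF this, of "\<lambda>_. f" "\<lambda>_. borel"] show ?thesis by simp
  qed
  have D: "distr ?\<Pi> borel (\<lambda>\<omega>. f (\<omega> i)) = distr (measure_pmf p) borel f" for i
    using distr_distr[OF f comp[of i]] unfolding law by (simp add: comp_def)
  have "weak_conv_m (\<lambda>n. distr ?\<Pi> borel (\<lambda>\<omega>. (\<Sum>i<n. f (\<omega> i) - m) / sqrt (real n * \<sigma>\<^sup>2)))
      std_normal_distribution"
    using P.central_limit_theorem[OF indep _ \<open>\<sigma> > 0\<close> _ _ D, of m]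
    using int var by (simp add: E I E[of "\<lambda>x. (f x - _)\<^sup>2"] I[of "\<lambda>x. (f x)\<^sup>2"] m_def)
  then have lim: "(\<lambda>n. cdf (distr ?\<Pi> borel (\<lambda>\<omega>. (\<Sum>i<n. f (\<omega> i) - m) / sqrt (real n * \<sigma>\<^sup>2))) t)
      \<longlonglongrightarrow> gaussian_cdf t"
    using isCont_gaussian_cdf[of t]
    by (simp add: weak_conv_m_def weak_conv_def cdf_std_normal_distribution)
  \<comment> \<open>At \<open>n = 0\<close> the two sides differ for negative \<open>t\<close>: the
    normalized sum is \<open>0 / 0 = 0\<close>, while the event on words reads
    \<open>0 \<le> 0\<close>.\<close>
  have "cdf (distr ?\<Pi> borel (\<lambda>\<omega>. (\<Sum>i<n. f (\<omega> i) - m) / sqrt (real n * \<sigma>\<^sup>2))) t =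
      measure_pmf.prob (replicate_pmf n p)
        {w. (\<Sum>x\<leftarrow>w. f x) \<le> real n * m + \<sigma> * t * sqrt (real n)}" (is "_ = measure_pmf.prob _ ?A")
    if "n \<ge> 1" for n
  proof -
    have sum: "(\<Sum>x\<leftarrow>map \<omega> [0..<n]. f x) = (\<Sum>i<n. f (\<omega> i))" for \<omega> :: "nat \<Rightarrow> 'a"
      by (simp add: comp_def interv_sum_list_conv_sum_set_nat atLeast0LessThan)
    have "measure_pmf.prob (replicate_pmf n p) ?A =
        measure ?\<Pi> ((\<lambda>\<omega>. map \<omega> [0..<n]) -` ?A \<inter> space ?\<Pi>)"
      unfolding distr_PiM_map_eq_replicate_pmf(2)[symmetric]
      by (intro measure_distr distr_PiM_map_eq_replicate_pmf(1)) auto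
    also have "(\<lambda>\<omega>. map \<omega> [0..<n]) -` ?A \<inter> space ?\<Pi> =
        (\<lambda>\<omega>. (\<Sum>i<n. f (\<omega> i) - m) / sqrt (real n * \<sigma>\<^sup>2)) -` {..t} \<inter> space ?\<Pi>"
      using that \<open>\<sigma> > 0\<close> unfolding vimage_def mem_Collect_eq sum
      by (auto simp: sum_subtractf real_sqrt_mult divide_simps algebra_simps)
    finally show ?thesis
      using X by (simp add: cdf_def measure_distr)
  qed
  then have "\<forall>\<^sub>F n in sequentially.
      cdf (distr ?\<Pi> borel (\<lambda>\<omega>. (\<Sum>i<n. f (\<omega> i) - m) / sqrt (real n * \<sigma>\<^sup>2))) t =
      measure_pmf.prob (replicate_pmf n p)
        {w. (\<Sum>x\<leftarrow>w. f x) \<le> real n * m + \<sigma> * t * sqrt (real n)}"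
    by (auto simp: eventually_sequentially)
  from Lim_transform_eventually[OF lim this] show ?thesis
    by (simp add: m_def)
qed

section \<open>The asymptotic converse at scale \<open>sqrt n\<close>\<close>

theorem theorem4:
  fixes P :: "('x::finite \<times> 'z::finite) pmf"
    and b \<sigma> :: real
    and M :: "nat \<Rightarrow> nat"
    and \<phi> :: "nat \<Rightarrow> 'x list \<Rightarrow> nat"
    and \<psi> :: "nat \<Rightarrow> nat \<Rightarrow> 'z list \<Rightarrow> 'x list"
  assumes "conditional_information_variance P > 0"
    and "\<sigma> = sqrt (conditional_information_variance P)"
    and "\<And>n. n \<ge> 1 \<Longrightarrow> slepian_wolf_code n (M n) (\<phi> n) (\<psi> n)"
    and "limsup (\<lambda>n. ereal (error_probability P n (\<phi> n) (\<psi> n))) < ereal (1 - gaussian_cdf (b / \<sigma>))"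
  shows "liminf (\<lambda>n. ereal (1 / sqrt (real n) *
           ln (real (M n) / exp (real n * conditional_shannon_entropy P)))) \<ge> ereal b"
proof (rule ccontr)
  let ?f = "\<lambda>(x, z). ln (1 / conditional_mass P x z)"
  let ?H = "conditional_shannon_entropy P"
  let ?r = "\<lambda>n. 1 / sqrt (real n) * ln (real (M n) / exp (real n * ?H))"
  let ?\<epsilon> = "\<lambda>n. error_probability P n (\<phi> n) (\<psi> n)"
  assume "\<not> liminf (\<lambda>n. ereal (?r n)) \<ge> ereal b"
  then have "liminf (\<lambda>n. ereal (?r n)) < ereal b" by simp
  then obtain c where c: "liminf (\<lambda>n. ereal (?r n)) < ereal c" "ereal c < ereal b"
    using ereal_dense2 by blast
  \<comment> \<open>The gap \<open>d - c\<close> makes the message-counting term decay like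
    \<open>exp (- (d - c) * sqrt n)\<close>, while \<open>d < b\<close> keeps the Gaussian limit at
    most \<open>gaussian_cdf (b / \<sigma>)\<close>.\<close>
  define d where "d = (b + c) / 2"
  have d: "c < d" "d < b" using c by (auto simp: d_def)
  have \<sigma>: "\<sigma> > 0" "measure_pmf.variance P ?f = \<sigma>\<^sup>2"
    using assms(1,2) by (auto simp: conditional_information_variance_def)
  define F where "F n = measure_pmf.prob (replicate_pmf n P)
    {w. conditional_information P w \<le> real n * ?H + d * sqrt (real n)}" for n
  have "F \<longlonglongrightarrow> gaussian_cdf (d / \<sigma>)"
    using replicate_pmf_central_limit[OF _ \<sigma>(2,1), of "d / \<sigma>"] \<sigma>(1)
    by (simp add: F_def[abs_def] conditional_information_def conditional_shannon_entropy_eq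
        integrable_measure_pmf_finite)
  moreover have "(\<lambda>n. exp (- ((d - c) * sqrt (real n)))) \<longlonglongrightarrow> 0"
    using d by real_asymp
  ultimately have lim: "(\<lambda>n. F n + exp (- ((d - c) * sqrt (real n)))) \<longlonglongrightarrow> gaussian_cdf (d / \<sigma>)"
    using tendsto_add[of F "gaussian_cdf (d / \<sigma>)"] by fastforce
  have "gaussian_cdf (d / \<sigma>) \<le> gaussian_cdf (b / \<sigma>)"
    using d \<sigma>(1) by (intro gaussian_cdf_mono divide_right_mono) auto
  \<comment> \<open>A constant \<open>e\<close> strictly between the two sides turns the limsup
    hypothesis into an eventual bound on the error.\<close>
  moreover obtain e where e: "limsup (\<lambda>n. ereal (?\<epsilon> n)) < ereal e" "ereal e < ereal (1 - gaussian_cdf (b / \<sigma>))"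
    using ereal_dense2[OF assms(4)] by blast
  ultimately have "gaussian_cdf (d / \<sigma>) < 1 - e" by simp
  from order_tendstoD(2)[OF lim this]
  have "\<forall>\<^sub>F n in sequentially. F n + exp (- ((d - c) * sqrt (real n))) < 1 - e" .
  moreover have "\<forall>\<^sub>F n in sequentially. ereal (?\<epsilon> n) < ereal e"
    using e(1) by (rule Limsup_lessD)
  \<comment> \<open>A small liminf gives small rates only infinitely often; as the other bounds hold
    eventually, one common \<open>n\<close> exists.\<close>
  moreover have "\<exists>\<^sub>F n in sequentially. ereal (?r n) < ereal c"
  proof (rule ccontr)
    assume "\<not> (\<exists>\<^sub>F n in sequentially. ereal (?r n) < ereal c)"
    then have "\<forall>\<^sub>F n in sequentially. ereal c \<le> ereal (?r n)"
      by (simp add: frequently_def not_less)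
    then have "ereal c \<le> liminf (\<lambda>n. ereal (?r n))"
      by (rule Liminf_bounded)
    with c show False by simp
  qed
  ultimately have "\<exists>\<^sub>F n in sequentially. ereal (?r n) < ereal c \<and>
      (ereal (?\<epsilon> n) < ereal e \<and> n \<ge> 1 \<and> F n + exp (- ((d - c) * sqrt (real n))) < 1 - e)"
    using eventually_ge_at_top[of "1::nat"]
    by (intro frequently_eventually_frequently eventually_conj)
  then obtain n where n: "?r n < c" "?\<epsilon> n < e" "n \<ge> 1"
      "F n + exp (- ((d - c) * sqrt (real n))) < 1 - e"
    by (auto dest: frequently_ex)
  have code: "slepian_wolf_code n (M n) (\<phi> n) (\<psi> n)" using assms(3) n(3) .
  \<comment> \<open>Some word of length \<open>n\<close> exists and must be encoded, so there is at
    least one message. This excludes the default value \<open>ln 0 = 0\<close>.\<close>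
  have "\<phi> n (replicate n undefined) \<in> {1..M n}"
    using code by (simp add: slepian_wolf_code_def)
  then have M: "real (M n) > 0" by auto
  have "ln (real (M n)) < real n * ?H + c * sqrt (real n)"
    using n(1,3) M by (simp add: ln_div field_simps)
  then have "real (M n) < exp (real n * ?H + c * sqrt (real n))"
    using M by (metis exp_less_mono exp_ln)
  then have "real (M n) * exp (- (real n * ?H + d * sqrt (real n))) <
      exp (real n * ?H + c * sqrt (real n)) * exp (- (real n * ?H + d * sqrt (real n)))"
    by simp
  also have "\<dots> = exp (- ((d - c) * sqrt (real n)))"
    by (simp add: exp_add[symmetric] algebra_simps)
  finally have "1 - ?\<epsilon> n < F n + exp (- ((d - c) * sqrt (real n)))"
    using success_probability_le[OF code, of P "real n * ?H + d * sqrt (real n)"]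
    unfolding F_def by linarith
  with n show False by linarith
qed

end
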